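(* Let $G=\{g_1,\dots,g_n\}$ be a finite abelian group with identity $g_1$, let $\chi_1,\dots,\chi_n$ be its distinct characters, and let $D$ be the adjacency matrix of $\Gamma=\mathrm{BiCay}(G;R,L,T)$, with rows and columns indexed by $(g_1)_0,\dots,(g_n)_0,(g_1)_1,\dots,(g_n)_1$. Then the eigenvalues of $D$ are $\lambda_{2k-j}$ for $k=1,\dots,n$ and $j=0,1$, where $\lambda_{2k-j}=\frac{\chi_k(R)+\chi_k(L)+(-1)^j\sqrt{(\chi_k(R)-\chi_k(L))^2+4|\chi_k(T)|^2}}{2}$. Moreover, an eigenvector of $D$ for $\lambda_{2k-j}$ is $\hat U u_{2k-j}$, where $\hat U=\begin{pmatrix}P&0\\0&P\end{pmatrix}$ with $P=\frac{1}{\sqrt n}(\chi_g(h))_{h,g\in G}$ (entry in row $g_a$, column $g_b$ equal to $\chi_b(g_a)$), and $u_{2k-j}$ is the vector of length $2n$ whose only possibly nonzero entries are $\xi_{k,2+(-1)^j}/c$ in position $k$ and $\xi_{k,3+(-1)^j}/c$ in position $n+k$, with $c=\sqrt{|\xi_{k,2+(-1)^j}|^2+|\xi_{k,3+(-1)^j}|^2}$, where $(\xi_{k,1},\xi_{k,2})=(0,1)$ if $\chi_k(T)=0$ and $\chi_k(R)>\chi_k(L)$; $=(1,0)$ if $\chi_k(T)=0$ and $\chi_k(R)\le\chi_k(L)$; $=(\frac{\chi_k(T)}{\lambda_{2k-1}-\chi_k(R)},1)$ if $\chi_k(T)\neq0$; and $(\xi_{k,3},\xi_{k,4})=(1,0)$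 if $\chi_k(T)=0$ and $\chi_k(R)>\chi_k(L)$; $=(0,1)$ if $\chi_k(T)=0$ and $\chi_k(R)\le\chi_k(L)$; $=(1,\frac{\overline{\chi_k(T)}}{\lambda_{2k}-\chi_k(L)})$ if $\chi_k(T)\neq0$. These $2n$ eigenvectors $\hat Uu_{2k-j}$ are mutually orthogonal.
   Context: For $S\subseteq G$ and a character $\chi$, $\chi(S)=\sum_{s\in S}\chi(s)$, $\chi(\emptyset)=0$. Given $R,L,T\subseteq G$ with $R=R^{-1}$, $L=L^{-1}$, identity not in $R\cup L$, $\mathrm{BiCay}(G;R,L,T)$ has vertex set $G_0\cup G_1$, $G_i=\{g_i\mid g\in G\}$ disjoint copies of $G$, and edges $\{h_0,g_0\}$ when $gh^{-1}\in R$, $\{h_1,g_1\}$ when $gh^{-1}\in L$, $\{h_0,g_1\}$ when $gh^{-1}\in T$. *)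

theory Defs
  imports
    "HOL-Algebra.Coset"
    "HOL-Library.Complex_Order"
    "Jordan_Normal_Form.Spectral_Radius"
begin

section \<open>Characters of a group\<close>

definition complex_units :: "complex monoid" where
  "complex_units = \<lparr>carrier = UNIV - {0}, mult = (*), one = 1\<rparr>"

text \<open>Characters are made extensional, so that two of them are equal as HOL functions exactly
  if they agree on the group.\<close>

definition characters :: "('a, 'b) monoid_scheme \<Rightarrow> ('a \<Rightarrow> complex) set" where
  "characters G = hom G complex_units \<inter> extensional (carrier G)"

definition char_sum :: "('a \<Rightarrow> complex) \<Rightarrow> 'a set \<Rightarrow> complex" where
  "char_sum \<psi> S = (\<Sum>s\<in>S. \<psi> s)"

section \<open>Bi-Cayley graphs and adjacency matrices\<close>

text \<open>An undirected simple graph is a pair of a vertex set and a set of two-element vertex sets.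
  The two copies $g_0$ and $g_1$ of a group element $g$ are \<open>Inl g\<close> and \<open>Inr g\<close>.\<close>

type_synonym 'v ugraph = "'v set \<times> 'v set set"

definition BiCay ::
  "('a, 'b) monoid_scheme \<Rightarrow> 'a set \<Rightarrow> 'a set \<Rightarrow> 'a set \<Rightarrow> ('a + 'a) ugraph" where
  "BiCay G R L T =
    (Inl ` carrier G \<union> Inr ` carrier G,
     {{Inl h, Inl g} | h g. h \<in> carrier G \<and> g \<in> carrier G \<and> g \<otimes>\<^bsub>G\<^esub> inv\<^bsub>G\<^esub> h \<in> R} \<union>
     {{Inr h, Inr g} | h g. h \<in> carrier G \<and> g \<in> carrier G \<and> g \<otimes>\<^bsub>G\<^esub> inv\<^bsub>G\<^esub> h \<in> L} \<union>
     {{Inl h, Inr g} | h g. h \<in> carrier G \<and> g \<in> carrier G \<and> g \<otimes>\<^bsub>G\<^esub> inv\<^bsub>G\<^esub> h \<in> T})"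

definition adjacency_mat :: "'v ugraph \<Rightarrow> 'v list \<Rightarrow> complex mat" where
  "adjacency_mat \<Gamma> vs =
    mat (length vs) (length vs) (\<lambda>(a, b). if {vs ! a, vs ! b} \<in> snd \<Gamma> then 1 else 0)"

definition bicay_vertex_list :: "(nat \<Rightarrow> 'a) \<Rightarrow> nat \<Rightarrow> ('a + 'a) list" where
  "bicay_vertex_list g n =
    map (\<lambda>i. Inl (g i)) [1..<Suc n] @ map (\<lambda>i. Inr (g i)) [1..<Suc n]"

section \<open>Eigenvalues and eigenvectors\<close>

text \<open>For inverse-closed \<open>R\<close> and \<open>L\<close> the sums \<open>char_sum \<psi> R\<close> and \<open>char_sum \<psi> L\<close> are real, so
  \<open>csqrt\<close> is applied to a nonnegative real and gives its nonnegative square root; likewise the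
  order on \<open>complex\<close> used in \<open>bicay_xi\<close> is the usual order of the reals.\<close>

text \<open>\<open>bicay_lambda R L T \<chi>\<^sub>k j\<close> is $\lambda_{2k-j}$.\<close>

definition bicay_lambda ::
  "'a set \<Rightarrow> 'a set \<Rightarrow> 'a set \<Rightarrow> ('a \<Rightarrow> complex) \<Rightarrow> nat \<Rightarrow> complex" where
  "bicay_lambda R L T \<psi> j =
    (char_sum \<psi> R + char_sum \<psi> L +
      (-1) ^ j * csqrt ((char_sum \<psi> R - char_sum \<psi> L)\<^sup>2
                          + 4 * (complex_of_real (cmod (char_sum \<psi> T)))\<^sup>2)) / 2"

text \<open>\<open>bicay_xi R L T \<chi>\<^sub>k i\<close> is $\xi_{k,i}$ for $i = 1,\dots,4$.\<close>

definition bicay_xi ::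
  "'a set \<Rightarrow> 'a set \<Rightarrow> 'a set \<Rightarrow> ('a \<Rightarrow> complex) \<Rightarrow> nat \<Rightarrow> complex" where
  "bicay_xi R L T \<psi> i =
    (if char_sum \<psi> T = 0 then
       (if char_sum \<psi> R > char_sum \<psi> L then [0, 1, 1, 0] else [1, 0, 0, 1])
     else
       [char_sum \<psi> T / (bicay_lambda R L T \<psi> 1 - char_sum \<psi> R), 1,
        1, cnj (char_sum \<psi> T) / (bicay_lambda R L T \<psi> 0 - char_sum \<psi> L)]) ! (i - 1)"

text \<open>Vector and matrix indices start at 0, so the 1-based position $k$ is the index \<open>i\<close> with
  \<open>Suc i = k\<close>.\<close>

definition bicay_u ::
  "nat \<Rightarrow> 'a set \<Rightarrow> 'a set \<Rightarrow> 'a set \<Rightarrow> (nat \<Rightarrow> 'a \<Rightarrow> complex) \<Rightarrow> nat \<Rightarrow> nat \<Rightarrow> complex vec" where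
  "bicay_u n R L T \<chi> k j =
    (let x = bicay_xi R L T (\<chi> k) (nat (2 + (-1) ^ j));
         y = bicay_xi R L T (\<chi> k) (nat (3 + (-1) ^ j));
         c = complex_of_real (sqrt ((cmod x)\<^sup>2 + (cmod y)\<^sup>2))
     in vec (2 * n) (\<lambda>i. if Suc i = k then x / c else if Suc i = n + k then y / c else 0))"

definition character_mat :: "nat \<Rightarrow> (nat \<Rightarrow> 'a) \<Rightarrow> (nat \<Rightarrow> 'a \<Rightarrow> complex) \<Rightarrow> complex mat" where
  "character_mat n g \<chi> =
    complex_of_real (1 / sqrt (real n)) \<cdot>\<^sub>m mat n n (\<lambda>(a, b). \<chi> (Suc b) (g (Suc a)))"

definition bicay_U :: "nat \<Rightarrow> (nat \<Rightarrow> 'a) \<Rightarrow> (nat \<Rightarrow> 'a \<Rightarrow> complex) \<Rightarrow> complex mat" where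
  "bicay_U n g \<chi> =
    four_block_mat (character_mat n g \<chi>) (0\<^sub>m n n) (0\<^sub>m n n) (character_mat n g \<chi>)"

end

theory Submission
  imports Defs "HOL-Algebra.Multiplicative_Group"
begin

text \<open>Every character \<open>\<psi>\<close> is a common eigenvector of the four blocks of the adjacency matrix, with
  eigenvalues $\psi(R)$, $\psi(T)$, $\overline{\psi(T)}$ and $\psi(L)$. On vectors of the form
  $(x\psi, y\psi)$ the adjacency matrix therefore acts as the Hermitian two-by-two matrix with these
  entries. Its two orthogonal eigenvectors $(x, y)$, together with the orthogonality of distinct
  characters, yield $2n$ orthogonal eigenvectors, and these determine the characteristic
  polynomial.\<close>

section \<open>Orthogonal eigenbases\<close>

text \<open>Nonzero orthogonal vectors, \<open>N\<close> of them, form the columns of an invertible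
  matrix \<open>W\<close>, and \<open>W\<close> conjugates \<open>A\<close> into a diagonal matrix.
  The family is indexed by an arbitrary finite set and \<open>l\<close> may repeat values, so
  multiplicities survive.\<close>

lemma char_poly_orthogonal_eigenbasis:
  fixes A :: "complex mat" and v :: "'i \<Rightarrow> complex vec"
  assumes A: "A \<in> carrier_mat N N" and I: "finite I" "card I = N"
    and ev: "\<And>i. i \<in> I \<Longrightarrow> eigenvector A (v i) (l i)"
    and orth: "\<And>i j. i \<in> I \<Longrightarrow> j \<in> I \<Longrightarrow> i \<noteq> j \<Longrightarrow> v i \<bullet>c v j = 0"
  shows "char_poly A = (\<Prod>i\<in>I. [:- l i, 1:])"
proof -
  obtain xs where xs: "set xs = I" "distinct xs"
    using finite_distinct_list[OF I(1)] by blast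
  have len: "length xs = N"
    using xs I distinct_card by fastforce
  have mem: "xs ! i \<in> I" if "i < N" for i
    using that xs len by auto
  have car: "v i \<in> carrier_vec N" if "i \<in> I" for i
    using ev[OF that] A unfolding eigenvector_def by auto
  define W where "W = mat_of_cols N (map v (map ((!) xs) [0..<N]))"
  define W' where "W' = corthogonal_inv W"
  define B where "B = mat N N (\<lambda>(i, j). if i = j then l (xs ! i) else 0)"
  have W: "W \<in> carrier_mat N N" and B: "B \<in> carrier_mat N N"
    unfolding W_def B_def by auto
  have W': "W' \<in> carrier_mat N N"
    using W unfolding W'_def corthogonal_inv_def by (auto simp: mat_of_rows_def)
  have col: "col W i = v (xs ! i)" if "i < N" for i
    using that mem car unfolding W_def by (subst col_mat_of_cols) auto
  \<comment> \<open>The notion is an equivalence: products of distinct columns vanish by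
    orthogonality, and the product of a column with itself does not vanish because eigenvectors are
    nonzero.\<close>
  have "corthogonal_mat W"
  proof (rule corthogonal_matI)
    fix i j assume ij: "i < dim_col W" "j < dim_col W"
    then have ij': "i < N" "j < N" using W by auto
    show "(col W i \<bullet>c col W j = 0) = (i \<noteq> j)"
    proof (cases "i = j")
      case True
      have "v (xs ! i) \<noteq> 0\<^sub>v N"
        using ev[OF mem[OF ij'(1)]] A unfolding eigenvector_def by auto
      then show ?thesis
        using True col ij' conjugate_square_eq_0_vec[OF car[OF mem[OF ij'(1)]]] by auto
    next
      case False
      then have "xs ! i \<noteq> xs ! j"
        using xs(2) ij' len nth_eq_iff_index_eq by blast
      then show ?thesis
        using False col ij' orth mem by auto
    qed
  qed
  then have W'W: "W' * W = 1\<^sub>m N"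
    using corthogonal_inv_result W' unfolding W'_def inverts_mat_def by fastforce
  \<comment> \<open>For square matrices a left inverse is also a right inverse; the similarity to
    \<open>B\<close> uses both identities.\<close>
  then have WW': "W * W' = 1\<^sub>m N"
    using mat_mult_left_right_inverse[OF W' W] by blast
  have "A * W = W * B"
  proof (rule eq_matI)
    fix i j assume "i < dim_row (W * B)" "j < dim_col (W * B)"
    then have ij: "i < N" "j < N" using W B by auto
    have "(A * W) $$ (i, j) = (A *\<^sub>v v (xs ! j)) $ i"
      using A W ij col by simp
    also have "\<dots> = l (xs ! j) * v (xs ! j) $ i"
      using ev[OF mem[OF ij(2)]] car[OF mem[OF ij(2)]] ij unfolding eigenvector_def by auto
    also have "\<dots> = l (xs ! j) * W $$ (i, j)"
      using col[OF ij(2), symmetric] W ij by simp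
    \<comment> \<open>Column \<open>j\<close> of \<open>B\<close> has its only possible nonzero
      entry at row \<open>j\<close>, so the product sum collapses to a single term.\<close>
    also have "\<dots> = (\<Sum>m\<in>{0..<N}. W $$ (i, m) * (if m = j then l (xs ! m) else 0))"
      using ij by (simp add: if_distrib sum.delta cong: if_cong)
    also have "\<dots> = (W * B) $$ (i, j)"
      using W ij unfolding B_def by (simp add: scalar_prod_def)
    finally show "(A * W) $$ (i, j) = (W * B) $$ (i, j)" .
  qed (use A W B in auto)
  then have "W * B * W' = A * (W * W')"
    using A W W' by (metis assoc_mult_mat)
  then have "A = W * B * W'"
    using WW' A by simp
  then have "similar_mat A B"
    unfolding similar_mat_def using similar_mat_witI[OF WW' W'W _ A B W W'] by blast
  then have "char_poly A = char_poly B"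
    by (rule char_poly_similar)
  also have "\<dots> = (\<Prod>a\<leftarrow>diag_mat B. [:- a, 1:])"
    using B by (intro char_poly_upper_triangular) (auto simp: B_def)
  also have "diag_mat B = map l xs"
    using len by (intro nth_equalityI) (auto simp: diag_mat_def B_def)
  also have "(\<Prod>a\<leftarrow>map l xs. [:- a, 1:]) = (\<Prod>i\<in>I. [:- l i, 1:])"
    using xs prod.distinct_set_conv_list[of xs "\<lambda>i. [:- l i, 1:]"] by (simp add: o_def)
  finally show ?thesis .
qed

text \<open>Each linear factor of the characteristic polynomial contributes one root, so coinciding
  values of \<open>l\<close> add up to the algebraic multiplicity.\<close>

lemma proots_orthogonal_eigenbasis:
  fixes A :: "complex mat" and v :: "'i \<Rightarrow> complex vec"
  assumes "A \<in> carrier_mat N N" "finite I" "card I = N"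
    and "\<And>i. i \<in> I \<Longrightarrow> eigenvector A (v i) (l i)"
    and "\<And>i j. i \<in> I \<Longrightarrow> j \<in> I \<Longrightarrow> i \<noteq> j \<Longrightarrow> v i \<bullet>c v j = 0"
  shows "proots (char_poly A) = image_mset l (mset_set I)"
proof -
  have "proots (char_poly A) = (\<Sum>i\<in>I. proots [:- l i, 1:])"
    using char_poly_orthogonal_eigenbasis[OF assms] by (simp add: proots_prod)
  also have "\<dots> = image_mset l (mset_set I)"
    using assms(2) by (induction I) auto
  finally show ?thesis .
qed

lemma spectrum_orthogonal_eigenbasis:
  fixes A :: "complex mat" and v :: "'i \<Rightarrow> complex vec"
  assumes A: "A \<in> carrier_mat N N" and "finite I" "card I = N"
    and "\<And>i. i \<in> I \<Longrightarrow> eigenvector A (v i) (l i)"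
    and "\<And>i j. i \<in> I \<Longrightarrow> j \<in> I \<Longrightarrow> i \<noteq> j \<Longrightarrow> v i \<bullet>c v j = 0"
  shows "spectrum A = l ` I"
proof -
  have "char_poly A = (\<Prod>i\<in>I. [:- l i, 1:])"
    by (rule char_poly_orthogonal_eigenbasis[OF assms])
  then have "eigenvalue A k \<longleftrightarrow> k \<in> l ` I" for k
    using assms(2) by (auto simp: eigenvalue_root_char_poly[OF A] poly_prod)
  then show ?thesis
    unfolding spectrum_def by blast
qed

section \<open>Hermitian two-by-two matrices\<close>

text \<open>In the degenerate case \<open>char_sum \<psi> T = 0\<close> the larger eigenvalue is the larger diagonal entry;
  the case distinction in \<open>bicay_xi\<close> selects the matching unit vector.\<close>

lemma bicay_xi_eigen:
  fixes \<psi> :: "'a \<Rightarrow> complex" and R L T :: "'a set"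
  assumes R: "char_sum \<psi> R \<in> \<real>" and L: "char_sum \<psi> L \<in> \<real>" and j: "j \<in> {0, 1}"
  defines "x \<equiv> bicay_xi R L T \<psi> (nat (2 + (-1) ^ j))"
    and "y \<equiv> bicay_xi R L T \<psi> (nat (3 + (-1) ^ j))"
  shows "char_sum \<psi> R * x + char_sum \<psi> T * y = bicay_lambda R L T \<psi> j * x"
    and "cnj (char_sum \<psi> T) * x + char_sum \<psi> L * y = bicay_lambda R L T \<psi> j * y"
    and "x \<noteq> 0 \<or> y \<noteq> 0"
    and "bicay_xi R L T \<psi> 3 * cnj (bicay_xi R L T \<psi> 1)
          + bicay_xi R L T \<psi> 4 * cnj (bicay_xi R L T \<psi> 2) = 0"
proof -
  obtain r l where rl: "char_sum \<psi> R = complex_of_real r" "char_sum \<psi> L = complex_of_real l"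
    using R L by (auto elim!: Reals_cases)
  define t where "t = char_sum \<psi> T"
  \<comment> \<open>The real root in the formula for the eigenvalues, hence the gap between the
    larger eigenvalue (\<open>j = 0\<close>) and the smaller one (\<open>j = 1\<close>).\<close>
  define s where "s = sqrt ((r - l)\<^sup>2 + 4 * (cmod t)\<^sup>2)"
  have "csqrt ((char_sum \<psi> R - char_sum \<psi> L)\<^sup>2 + 4 * (complex_of_real (cmod t))\<^sup>2) = s"
    using csqrt_of_real_nonneg[of "(r - l)\<^sup>2 + 4 * (cmod t)\<^sup>2"] unfolding s_def rl by simp
  then have lam: "bicay_lambda R L T \<psi> 0 = complex_of_real ((r + l + s) / 2)"
    "bicay_lambda R L T \<psi> 1 = complex_of_real ((r + l - s) / 2)"
    unfolding bicay_lambda_def rl t_def by auto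
  have s2: "s\<^sup>2 = (r - l)\<^sup>2 + 4 * (cmod t)\<^sup>2" and s0: "s \<ge> 0"
    unfolding s_def by auto
  have tt: "4 * (cnj t * t) = complex_of_real (s\<^sup>2 - (r - l)\<^sup>2)"
    unfolding s2 using complex_norm_square[of t] by (simp add: mult.commute)
  have all: "(char_sum \<psi> R * x + char_sum \<psi> T * y = bicay_lambda R L T \<psi> j * x)
    \<and> (cnj (char_sum \<psi> T) * x + char_sum \<psi> L * y = bicay_lambda R L T \<psi> j * y)
    \<and> (x \<noteq> 0 \<or> y \<noteq> 0)
    \<and> (bicay_xi R L T \<psi> 3 * cnj (bicay_xi R L T \<psi> 1)
          + bicay_xi R L T \<psi> 4 * cnj (bicay_xi R L T \<psi> 2) = 0)"
  proof (cases "t = 0")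
    case True
    then have "s = (if r > l then r - l else l - r)"
      unfolding s_def by simp
    then show ?thesis
      using True j unfolding x_def y_def bicay_xi_def lam[unfolded One_nat_def] rl t_def
      by (auto simp: lam[unfolded One_nat_def] less_complex_def)
  next
    case False
    \<comment> \<open>The same number is \<lambda> - l for the larger eigenvalue and r - \<lambda>
      for the smaller one, so both denominators in \<open>bicay_xi\<close> are \<open>d\<close> up
      to sign.\<close>
    define d where "d = complex_of_real ((r - l + s) / 2)"
    have "(cmod t)\<^sup>2 > 0" using False by simp
    then have "(r - l)\<^sup>2 < s\<^sup>2" using s2 by simp
    \<comment> \<open>Strictness comes from a nonzero off-diagonal entry \<open>t\<close>; it makes
      \<open>d\<close> positive, so neither quotient divides by zero.\<close>
    then have "\<bar>r - l\<bar> < s" using s0 by (metis abs_le_square_iff abs_of_nonneg not_le)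
    then have d0: "d \<noteq> 0"
      unfolding d_def of_real_eq_0_iff by auto
    have d: "bicay_lambda R L T \<psi> 0 = l + d" "bicay_lambda R L T \<psi> 1 = r - d" "cnj d = d"
      unfolding lam d_def by (simp_all add: field_simps)
    \<comment> \<open>This is the characteristic equation of the two-by-two matrix, written in terms
      of \<open>d\<close>; both eigenvector equations reduce to it.\<close>
    have td: "cnj t * t = d * (d - r + l)"
      using tt unfolding d_def by (simp add: field_simps power2_eq_square)
    have xi: "bicay_xi R L T \<psi> 1 = - t / d" "bicay_xi R L T \<psi> 2 = 1"
      "bicay_xi R L T \<psi> 3 = 1" "bicay_xi R L T \<psi> 4 = cnj t / d"
      using False unfolding bicay_xi_def d rl t_def by auto
    \<comment> \<open>Since \<open>d\<close> is real, the two summands are the conjugate of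
      \<open>t\<close> over \<open>d\<close> with opposite signs.\<close>
    have xi_orth: "bicay_xi R L T \<psi> 3 * cnj (bicay_xi R L T \<psi> 1)
        + bicay_xi R L T \<psi> 4 * cnj (bicay_xi R L T \<psi> 2) = 0"
      unfolding xi using d(3) by simp
    have td': "cnj t * t / d = d - r + l"
      unfolding td using d0 by simp
    from j consider "j = 0" | "j = 1" by blast
    then show ?thesis
    proof cases
      assume "j = 0"
      \<comment> \<open>For \<open>j = 0\<close> the index arithmetic selects entries 3 and 4 of
        \<open>bicay_xi\<close>; for \<open>j = 1\<close> it selects entries 1 and 2.\<close>
      then have "x = 1" "y = cnj t / d"
        unfolding x_def y_def using xi by simp_all
      then show ?thesis
        using td' d0 xi_orth d(1) \<open>j = 0\<close> unfolding rl t_def[symmetric]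
        by (simp add: algebra_simps add_divide_distrib diff_divide_distrib)
    next
      assume "j = 1"
      then have "x = - t / d" "y = 1"
        unfolding x_def y_def using xi by simp_all
      then show ?thesis
        using td' d0 xi_orth unfolding rl t_def[symmetric] \<open>j = 1\<close> d(2)
        by (simp add: algebra_simps add_divide_distrib diff_divide_distrib)
    qed
  qed
  then show "char_sum \<psi> R * x + char_sum \<psi> T * y = bicay_lambda R L T \<psi> j * x"
    and "cnj (char_sum \<psi> T) * x + char_sum \<psi> L * y = bicay_lambda R L T \<psi> j * y"
    and "x \<noteq> 0 \<or> y \<noteq> 0"
    and "bicay_xi R L T \<psi> 3 * cnj (bicay_xi R L T \<psi> 1)
          + bicay_xi R L T \<psi> 4 * cnj (bicay_xi R L T \<psi> 2) = 0"
    by blast+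
qed

section \<open>Characters of finite abelian groups\<close>

context comm_group
begin

lemma character_mult:
  "\<psi> \<in> characters G \<Longrightarrow> a \<in> carrier G \<Longrightarrow> b \<in> carrier G \<Longrightarrow> \<psi> (a \<otimes> b) = \<psi> a * \<psi> b"
  unfolding characters_def by (auto simp: hom_def complex_units_def)

lemma character_nonzero: "\<psi> \<in> characters G \<Longrightarrow> a \<in> carrier G \<Longrightarrow> \<psi> a \<noteq> 0"
  unfolding characters_def by (auto simp: hom_def complex_units_def)

lemma character_one:
  assumes "\<psi> \<in> characters G"
  shows "\<psi> \<one> = 1"
  using character_mult[OF assms, of \<one> \<one>] character_nonzero[OF assms, of \<one>] by simp

lemma character_pow:
  assumes "\<psi> \<in> characters G" "a \<in> carrier G"
  shows "\<psi> (a [^] (m::nat)) = \<psi> a ^ m"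
  using assms by (induction m) (auto simp: character_one character_mult)

text \<open>Element orders divide the group order, so the values of a character are roots of
  unity.\<close>

lemma norm_character:
  assumes "finite (carrier G)" "\<psi> \<in> characters G" "a \<in> carrier G"
  shows "cmod (\<psi> a) = 1"
proof -
  have "\<psi> a ^ Coset.order G = 1"
    using assms character_pow[of \<psi> a "Coset.order G"] pow_order_eq_1[of a]
    by (simp add: character_one[OF assms(2)])
  then have "cmod (\<psi> a) ^ Coset.order G = 1"
    by (simp flip: norm_power)
  moreover have "Coset.order G > 0"
    using assms(1) order_gt_0_iff_finite by blast
  ultimately show ?thesis
    using power_eq_iff_eq_base[of "Coset.order G" "cmod (\<psi> a)" 1] by simp
qed

lemma character_cnj_self:
  assumes "finite (carrier G)" "\<psi> \<in> characters G" "a \<in> carrier G"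
  shows "\<psi> a * cnj (\<psi> a) = 1"
  using norm_character[OF assms] by (simp flip: complex_norm_square)

lemma character_inv:
  assumes "finite (carrier G)" "\<psi> \<in> characters G" "a \<in> carrier G"
  shows "\<psi> (inv a) = cnj (\<psi> a)"
proof -
  have "\<psi> a * \<psi> (inv a) = \<psi> a * cnj (\<psi> a)"
    using assms character_mult[of \<psi> a "inv a"]
    by (simp add: character_one[OF assms(2)] character_cnj_self)
  then show ?thesis
    using character_nonzero assms by simp
qed

text \<open>Inversion permutes the summands, and a value of modulus one has its conjugate as
  inverse. For inverse-closed sets this makes the sum real.\<close>

lemma char_sum_set_inv:
  assumes "finite (carrier G)" "\<psi> \<in> characters G" "S \<subseteq> carrier G"
  shows "char_sum \<psi> (set_inv S) = cnj (char_sum \<psi> S)"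
proof -
  have "set_inv S = m_inv G ` S"
    unfolding SET_INV_def by auto
  moreover have "inj_on (m_inv G) S"
    using assms(3) inv_inj inj_on_subset by blast
  ultimately have "char_sum \<psi> (set_inv S) = (\<Sum>s\<in>S. \<psi> (inv s))"
    unfolding char_sum_def by (simp add: sum.reindex)
  also have "\<dots> = cnj (char_sum \<psi> S)"
    unfolding char_sum_def cnj_sum using assms by (intro sum.cong) (auto simp: character_inv)
  finally show ?thesis .
qed

lemma char_sum_real:
  assumes "finite (carrier G)" "\<psi> \<in> characters G" "S \<subseteq> carrier G" "S = set_inv S"
  shows "char_sum \<psi> S \<in> \<real>"
  using char_sum_set_inv[OF assms(1-3)] unfolding assms(4)[symmetric] Reals_cnj_iff by (rule sym)

text \<open>Translating the summation variable by \<open>b\<close> multiplies the sum by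
  \<open>\<psi> b * cnj (\<phi> b)\<close>. If the sum were nonzero, this factor would be 1 for
  every \<open>b\<close>, forcing the characters to agree.\<close>

lemma character_orthogonal:
  assumes fin: "finite (carrier G)" and \<psi>: "\<psi> \<in> characters G" and \<phi>: "\<phi> \<in> characters G"
    and neq: "\<psi> \<noteq> \<phi>"
  shows "(\<Sum>a\<in>carrier G. \<psi> a * cnj (\<phi> a)) = 0"
proof (rule ccontr)
  let ?S = "\<Sum>a\<in>carrier G. \<psi> a * cnj (\<phi> a)"
  assume S: "?S \<noteq> 0"
  have "\<psi> b = \<phi> b" if b: "b \<in> carrier G" for b
  proof -
    have "?S = (\<Sum>a\<in>carrier G. \<psi> (b \<otimes> a) * cnj (\<phi> (b \<otimes> a)))"
      by (rule sum.reindex_bij_witness[where i = "\<lambda>a. b \<otimes> a" and j = "\<lambda>a. inv b \<otimes> a"])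
         (use b in \<open>auto simp flip: m_assoc\<close>)
    also have "\<dots> = (\<psi> b * cnj (\<phi> b)) * ?S"
      unfolding sum_distrib_left
      by (intro sum.cong) (use b \<psi> \<phi> in \<open>auto simp: character_mult\<close>)
    finally have "\<psi> b * cnj (\<phi> b) = 1"
      using S by simp
    then have "\<psi> b * (\<phi> b * cnj (\<phi> b)) = \<phi> b"
      by (simp add: algebra_simps)
    then show ?thesis
      using character_cnj_self[OF fin \<phi> b] by simp
  qed
  \<comment> \<open>Agreement on the group is equality of functions because characters are
    extensional.\<close>
  then have "\<psi> = \<phi>"
    using \<psi> \<phi> unfolding characters_def by (auto intro: extensionalityI)
  with neq show False ..
qed

text \<open>Substituting \<open>b = s \<otimes> a\<close>, respectively
  \<open>b = inv s \<otimes> a\<close>, turns the indicator sum into a sum over \<open>S\<close>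
  from which \<open>\<psi> a\<close> factors out. The two forms are the row sums of
  \<open>quotient_mat\<close> and of its transpose; inverting \<open>s\<close> produces the
  conjugate.\<close>

lemma character_convolution:
  assumes fin: "finite (carrier G)" and \<psi>: "\<psi> \<in> characters G" and S: "S \<subseteq> carrier G"
    and a: "a \<in> carrier G"
  shows "(\<Sum>b\<in>carrier G. (if b \<otimes> inv a \<in> S then 1 else 0) * \<psi> b) = char_sum \<psi> S * \<psi> a"
    and "(\<Sum>b\<in>carrier G. (if a \<otimes> inv b \<in> S then 1 else 0) * \<psi> b) = cnj (char_sum \<psi> S) * \<psi> a"
proof -
  have "(\<Sum>b\<in>carrier G. (if b \<otimes> inv a \<in> S then 1 else 0) * \<psi> b)
      = (\<Sum>b\<in>{b \<in> carrier G. b \<otimes> inv a \<in> S}. \<psi> b)"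
    using fin by (intro sum.mono_neutral_cong_right) auto
  also have "\<dots> = (\<Sum>s\<in>S. \<psi> (s \<otimes> a))"
    by (rule sum.reindex_bij_witness[where i = "\<lambda>s. s \<otimes> a" and j = "\<lambda>b. b \<otimes> inv a"])
       (use a S in \<open>auto simp: m_assoc subset_iff\<close>)
  also have "\<dots> = char_sum \<psi> S * \<psi> a"
    unfolding char_sum_def sum_distrib_right
    by (intro sum.cong) (use a S \<psi> in \<open>auto simp: character_mult subset_iff\<close>)
  finally show "(\<Sum>b\<in>carrier G. (if b \<otimes> inv a \<in> S then 1 else 0) * \<psi> b) = char_sum \<psi> S * \<psi> a" .
  \<comment> \<open>These identities say that the substitution and its reverse are mutually
    inverse.\<close>
  have 1: "inv (a \<otimes> inv b) \<otimes> a = b" if "b \<in> carrier G" for b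
    using that a by (simp add: inv_mult_group m_assoc)
  have 2: "a \<otimes> inv (inv s \<otimes> a) = s" if "s \<in> carrier G" for s
    using that a by (simp add: inv_mult_group m_assoc[symmetric])
  have "(\<Sum>b\<in>carrier G. (if a \<otimes> inv b \<in> S then 1 else 0) * \<psi> b)
      = (\<Sum>b\<in>{b \<in> carrier G. a \<otimes> inv b \<in> S}. \<psi> b)"
    using fin by (intro sum.mono_neutral_cong_right) auto
  also have "\<dots> = (\<Sum>s\<in>S. \<psi> (inv s \<otimes> a))"
    by (rule sum.reindex_bij_witness[where i = "\<lambda>s. inv s \<otimes> a" and j = "\<lambda>b. a \<otimes> inv b"])
       (use a S 1 2 in \<open>auto simp: subset_iff\<close>)
  also have "\<dots> = cnj (char_sum \<psi> S) * \<psi> a"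
    unfolding char_sum_def cnj_sum sum_distrib_right
    by (intro sum.cong) (use a S \<psi> fin in \<open>auto simp: character_mult character_inv subset_iff\<close>)
  finally show "(\<Sum>b\<in>carrier G. (if a \<otimes> inv b \<in> S then 1 else 0) * \<psi> b)
    = cnj (char_sum \<psi> S) * \<psi> a" .
qed

section \<open>Edges and block form of the adjacency matrix\<close>

lemma set_inv_closed_quotient_sym:
  assumes "S = set_inv S" "a \<in> carrier G" "b \<in> carrier G" "a \<otimes> inv b \<in> S"
  shows "b \<otimes> inv a \<in> S"
proof -
  have "inv (a \<otimes> inv b) \<in> set_inv S"
    unfolding SET_INV_def by (rule UN_I[OF assms(4)]) simp
  then have "inv (a \<otimes> inv b) \<in> S"
    by (simp only: assms(1)[symmetric])
  moreover have "inv (a \<otimes> inv b) = b \<otimes> inv a"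
    using assms(2,3) by (simp add: inv_mult_group)
  ultimately show ?thesis
    by (simp only:)
qed

text \<open>An unordered pair inside one copy can be read in two orientations, and closure of
  \<open>R\<close> and \<open>L\<close> under inversion makes both readings agree. In a mixed pair
  the constructors determine which endpoint plays the role of h.\<close>

lemma BiCay_edge_iff:
  assumes "R = set_inv R" "L = set_inv L" "a \<in> carrier G" "b \<in> carrier G"
  shows "{Inl a, Inl b} \<in> snd (BiCay G R L T) \<longleftrightarrow> b \<otimes> inv a \<in> R"
    and "{Inr a, Inr b} \<in> snd (BiCay G R L T) \<longleftrightarrow> b \<otimes> inv a \<in> L"
    and "{Inl a, Inr b} \<in> snd (BiCay G R L T) \<longleftrightarrow> b \<otimes> inv a \<in> T"
    and "{Inr b, Inl a} \<in> snd (BiCay G R L T) \<longleftrightarrow> b \<otimes> inv a \<in> T"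
proof -
  have *: "b \<otimes> inv a \<in> S \<longleftrightarrow> a \<otimes> inv b \<in> S" if "S = set_inv S" for S
    using set_inv_closed_quotient_sym[OF that] assms(3,4) by blast
  show "{Inl a, Inl b} \<in> snd (BiCay G R L T) \<longleftrightarrow> b \<otimes> inv a \<in> R"
    using assms(3,4) *[OF assms(1)] unfolding BiCay_def by (auto simp: doubleton_eq_iff)
  show "{Inr a, Inr b} \<in> snd (BiCay G R L T) \<longleftrightarrow> b \<otimes> inv a \<in> L"
    using assms(3,4) *[OF assms(2)] unfolding BiCay_def by (auto simp: doubleton_eq_iff)
  show "{Inl a, Inr b} \<in> snd (BiCay G R L T) \<longleftrightarrow> b \<otimes> inv a \<in> T"
    using assms(3,4) unfolding BiCay_def by (auto simp: doubleton_eq_iff)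
  then show "{Inr b, Inl a} \<in> snd (BiCay G R L T) \<longleftrightarrow> b \<otimes> inv a \<in> T"
    by (simp add: insert_commute)
qed

text \<open>The column element is divided by the row element, matching the direction in which
  \<open>BiCay\<close> tests membership. The shift by \<open>Suc\<close> reconciles indices from 0
  with an enumeration from 1.\<close>

definition quotient_mat :: "nat \<Rightarrow> (nat \<Rightarrow> 'a) \<Rightarrow> 'a set \<Rightarrow> complex mat" where
  "quotient_mat n g S =
    mat n n (\<lambda>(i, j). if g (Suc j) \<otimes> inv (g (Suc i)) \<in> S then 1 else 0)"

text \<open>In the lower left block the row is an \<open>Inr\<close> vertex and the column an
  \<open>Inl\<close> vertex, so membership in \<open>T\<close> is tested with row and column
  exchanged: hence the transpose.\<close>

lemma adjacency_mat_BiCay: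
  assumes g: "\<And>i. i < n \<Longrightarrow> g (Suc i) \<in> carrier G"
    and R: "R = set_inv R" and L: "L = set_inv L"
  shows "adjacency_mat (BiCay G R L T) (bicay_vertex_list g n) =
    four_block_mat (quotient_mat n g R) (quotient_mat n g T)
      (transpose_mat (quotient_mat n g T)) (quotient_mat n g L)"
    (is "?D = ?F")
proof (rule eq_matI)
  have len: "length (bicay_vertex_list g n) = n + n"
    unfolding bicay_vertex_list_def by simp
  have nth: "bicay_vertex_list g n ! i = (if i < n then Inl (g (Suc i)) else Inr (g (Suc (i - n))))"
    if "i < n + n" for i
    using that unfolding bicay_vertex_list_def by (auto simp: nth_append simp del: upt_Suc)
  show "dim_row ?D = dim_row ?F" "dim_col ?D = dim_col ?F"
    unfolding adjacency_mat_def quotient_mat_def by (auto simp: len)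
  fix i j assume "i < dim_row ?F" "j < dim_col ?F"
  then have ij: "i < n + n" "j < n + n"
    unfolding quotient_mat_def by auto
  have g': "i < n + n \<Longrightarrow> \<not> i < n \<Longrightarrow> g (Suc (i - n)) \<in> carrier G" for i
    by (intro g) auto
  show "?D $$ (i, j) = ?F $$ (i, j)"
    using ij g g' unfolding adjacency_mat_def quotient_mat_def
    by (auto simp: len nth BiCay_edge_iff[OF R L])
qed

end

section \<open>The eigenvectors\<close>

text \<open>An unnormalized column of the character table; the factor 1/sqrt n of
  \<open>character_mat\<close> is left out.\<close>

definition character_vec :: "nat \<Rightarrow> (nat \<Rightarrow> 'a) \<Rightarrow> ('a \<Rightarrow> complex) \<Rightarrow> complex vec" where
  "character_vec n g \<psi> = vec n (\<lambda>i. \<psi> (g (Suc i)))"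

lemma character_vec_carrier [simp]: "character_vec n g \<psi> \<in> carrier_vec n"
  unfolding character_vec_def by simp

lemma bij_betw_Suc_enumeration:
  assumes "bij_betw g {1..n} A"
  shows "bij_betw (\<lambda>i. g (Suc i)) {0..<n} A"
proof -
  have "bij_betw Suc {0..<n} {1..n}"
    by (intro bij_betwI[where g = "\<lambda>i. i - 1"]) auto
  then show ?thesis
    using bij_betw_trans[OF _ assms] unfolding o_def by blast
qed

lemma sum_Suc_enumeration:
  assumes "bij_betw g {1..n} A"
  shows "(\<Sum>i\<in>{0..<n}. f (g (Suc i))) = sum f A"
  using sum.reindex_bij_betw[OF bij_betw_Suc_enumeration[OF assms]] .

lemma character_vec_cscalar_prod:
  assumes "bij_betw g {1..n} A"
  shows "character_vec n g \<psi> \<bullet>c character_vec n g \<phi> = (\<Sum>a\<in>A. \<psi> a * cnj (\<phi> a))"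
  unfolding scalar_prod_def character_vec_def
  using sum_Suc_enumeration[OF assms, of "\<lambda>a. \<psi> a * cnj (\<phi> a)"] by simp

lemma conjugate_append_vec: "conjugate (v @\<^sub>v w) = conjugate v @\<^sub>v conjugate w"
  by (rule eq_vecI) auto

lemma smult_append_vec: "k \<cdot>\<^sub>v (v @\<^sub>v w) = k \<cdot>\<^sub>v v @\<^sub>v k \<cdot>\<^sub>v w"
  by (rule eq_vecI) auto

text \<open>Such vectors are tensor products of a pair of scalars with a vector, so their inner
  product factors. Orthogonality in either factor is enough.\<close>

lemma cscalar_prod_append_smult:
  fixes p q :: "complex vec"
  assumes p: "p \<in> carrier_vec n" and q: "q \<in> carrier_vec n"
  shows "(a \<cdot>\<^sub>v p @\<^sub>v b \<cdot>\<^sub>v p) \<bullet>c (c \<cdot>\<^sub>v q @\<^sub>v d \<cdot>\<^sub>v q) = (a * cnj c + b * cnj d) * (p \<bullet>c q)"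
proof -
  have "(a \<cdot>\<^sub>v p @\<^sub>v b \<cdot>\<^sub>v p) \<bullet>c (c \<cdot>\<^sub>v q @\<^sub>v d \<cdot>\<^sub>v q)
      = (a \<cdot>\<^sub>v p) \<bullet>c (c \<cdot>\<^sub>v q) + (b \<cdot>\<^sub>v p) \<bullet>c (d \<cdot>\<^sub>v q)"
    unfolding conjugate_append_vec by (rule scalar_prod_append) (use p q in auto)
  also have "\<dots> = (a * cnj c + b * cnj d) * (p \<bullet>c q)"
    using p q by (simp add: conjugate_smult_vec algebra_simps)
  finally show ?thesis .
qed

text \<open>The vector \<open>bicay_u\<close> is supported at positions k and n + k, so each
  diagonal block of \<open>bicay_U\<close> returns a multiple of its column k. All normalization is
  absorbed into one nonzero scalar \<open>d\<close>, which affects neither eigenvectors nor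
  orthogonality.\<close>

lemma bicay_U_mult_bicay_u:
  fixes \<chi> :: "nat \<Rightarrow> 'a \<Rightarrow> complex" and R L T :: "'a set"
  assumes k: "k \<in> {1..n}"
  defines "x \<equiv> \<lambda>j. bicay_xi R L T (\<chi> k) (nat (2 + (-1) ^ j))"
    and "y \<equiv> \<lambda>j. bicay_xi R L T (\<chi> k) (nat (3 + (-1) ^ j))"
  assumes xy: "x j \<noteq> 0 \<or> y j \<noteq> 0"
  obtains d where "d \<noteq> 0" "bicay_U n g \<chi> *\<^sub>v bicay_u n R L T \<chi> k j =
    (d * x j) \<cdot>\<^sub>v character_vec n g (\<chi> k) @\<^sub>v (d * y j) \<cdot>\<^sub>v character_vec n g (\<chi> k)"
proof -
  define c where "c = complex_of_real (sqrt ((cmod (x j))\<^sup>2 + (cmod (y j))\<^sup>2))"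
  define r where "r = complex_of_real (1 / sqrt (real n))"
  let ?P = "character_mat n g \<chi>" and ?e = "unit_vec n (k - 1) :: complex vec"
  have "(cmod (x j))\<^sup>2 + (cmod (y j))\<^sup>2 \<noteq> 0"
    using xy by (simp add: sum_power2_eq_zero_iff)
  then have c0: "c \<noteq> 0"
    unfolding c_def by simp
  have r0: "r \<noteq> 0"
    using k unfolding r_def by auto
  have P: "?P \<in> carrier_mat n n"
    unfolding character_mat_def by simp
  \<comment> \<open>Each half is a multiple of one unit vector; position k has index
    \<open>k - 1\<close>.\<close>
  have u: "bicay_u n R L T \<chi> k j = (x j / c) \<cdot>\<^sub>v ?e @\<^sub>v (y j / c) \<cdot>\<^sub>v ?e"
    unfolding bicay_u_def Let_def c_def x_def y_def
    by (rule eq_vecI) (use k in \<open>auto simp: unit_vec_def\<close>)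
  have e: "?P *\<^sub>v ?e = r \<cdot>\<^sub>v character_vec n g (\<chi> k)"
    using k unfolding character_mat_def character_vec_def r_def
    by (intro eq_vecI) auto
  have "bicay_U n g \<chi> *\<^sub>v bicay_u n R L T \<chi> k j
      = ?P *\<^sub>v ((x j / c) \<cdot>\<^sub>v ?e) @\<^sub>v ?P *\<^sub>v ((y j / c) \<cdot>\<^sub>v ?e)"
    unfolding bicay_U_def u by (rule mult_mat_vec_split[OF P P]) auto
  also have "\<dots> = (r / c * x j) \<cdot>\<^sub>v character_vec n g (\<chi> k)
      @\<^sub>v (r / c * y j) \<cdot>\<^sub>v character_vec n g (\<chi> k)"
    using mult_mat_vec[OF P, of ?e] e by (simp add: smult_smult_assoc mult.commute)
  finally show thesis
    using c0 r0 by (intro that[of "r / c"]) auto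
qed

section \<open>Characters as eigenvectors of the blocks\<close>

context comm_group
begin

lemma quotient_mat_mult_character_vec:
  assumes fin: "finite (carrier G)" and g: "bij_betw g {1..n} (carrier G)"
    and \<psi>: "\<psi> \<in> characters G" and S: "S \<subseteq> carrier G"
  shows "quotient_mat n g S *\<^sub>v character_vec n g \<psi> = char_sum \<psi> S \<cdot>\<^sub>v character_vec n g \<psi>"
    and "transpose_mat (quotient_mat n g S) *\<^sub>v character_vec n g \<psi>
      = cnj (char_sum \<psi> S) \<cdot>\<^sub>v character_vec n g \<psi>"
proof -
  have mem: "g (Suc i) \<in> carrier G" if "i < n" for i
    using that bij_betwE[OF g] by auto
  show "quotient_mat n g S *\<^sub>v character_vec n g \<psi> = char_sum \<psi> S \<cdot>\<^sub>v character_vec n g \<psi>"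
  proof (rule eq_vecI)
    fix i assume "i < dim_vec (char_sum \<psi> S \<cdot>\<^sub>v character_vec n g \<psi>)"
    then have i: "i < n" by (simp add: character_vec_def)
    show "(quotient_mat n g S *\<^sub>v character_vec n g \<psi>) $ i
        = (char_sum \<psi> S \<cdot>\<^sub>v character_vec n g \<psi>) $ i"
      using i character_convolution(1)[OF fin \<psi> S mem[OF i]]
        sum_Suc_enumeration[OF g, of "\<lambda>b. (if b \<otimes> inv (g (Suc i)) \<in> S then 1 else 0) * \<psi> b"]
      by (simp add: quotient_mat_def character_vec_def scalar_prod_def)
  qed (simp add: quotient_mat_def character_vec_def)
  show "transpose_mat (quotient_mat n g S) *\<^sub>v character_vec n g \<psi>
      = cnj (char_sum \<psi> S) \<cdot>\<^sub>v character_vec n g \<psi>"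
  proof (rule eq_vecI)
    fix i assume "i < dim_vec (cnj (char_sum \<psi> S) \<cdot>\<^sub>v character_vec n g \<psi>)"
    then have i: "i < n" by (simp add: character_vec_def)
    show "(transpose_mat (quotient_mat n g S) *\<^sub>v character_vec n g \<psi>) $ i
        = (cnj (char_sum \<psi> S) \<cdot>\<^sub>v character_vec n g \<psi>) $ i"
      using i character_convolution(2)[OF fin \<psi> S mem[OF i]]
        sum_Suc_enumeration[OF g, of "\<lambda>b. (if g (Suc i) \<otimes> inv b \<in> S then 1 else 0) * \<psi> b"]
      by (simp add: quotient_mat_def character_vec_def scalar_prod_def)
  qed (simp add: quotient_mat_def character_vec_def)
qed

text \<open>All four blocks act on the character vector by scalars, so the eigenvector equation for
  the whole matrix reduces to the two scalar equations assumed for \<open>x\<close> and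
  \<open>y\<close>.\<close>

lemma BiCay_eigenvector:
  assumes fin: "finite (carrier G)" and g: "bij_betw g {1..n} (carrier G)"
    and \<psi>: "\<psi> \<in> characters G"
    and S: "R \<subseteq> carrier G" "L \<subseteq> carrier G" "T \<subseteq> carrier G"
    and inv: "R = set_inv R" "L = set_inv L"
    and x: "char_sum \<psi> R * x + char_sum \<psi> T * y = l * x"
    and y: "cnj (char_sum \<psi> T) * x + char_sum \<psi> L * y = l * y"
    and nz: "x \<noteq> 0 \<or> y \<noteq> 0"
  shows "eigenvector (adjacency_mat (BiCay G R L T) (bicay_vertex_list g n))
    (x \<cdot>\<^sub>v character_vec n g \<psi> @\<^sub>v y \<cdot>\<^sub>v character_vec n g \<psi>) l"
proof -
  let ?p = "character_vec n g \<psi>" and ?v = "x \<cdot>\<^sub>v character_vec n g \<psi> @\<^sub>v y \<cdot>\<^sub>v character_vec n g \<psi>"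
  let ?D = "adjacency_mat (BiCay G R L T) (bicay_vertex_list g n)"
  have mem: "g (Suc i) \<in> carrier G" if "i < n" for i
    using that bij_betwE[OF g] by auto
  have D: "?D = four_block_mat (quotient_mat n g R) (quotient_mat n g T)
      (transpose_mat (quotient_mat n g T)) (quotient_mat n g L)"
    by (rule adjacency_mat_BiCay[OF _ inv]) (rule mem)
  have Q: "quotient_mat n g S \<in> carrier_mat n n" "transpose_mat (quotient_mat n g S) \<in> carrier_mat n n"
    for S unfolding quotient_mat_def by auto
  note Qv = quotient_mat_mult_character_vec[OF fin g \<psi>]
  have "?D *\<^sub>v ?v =
      (quotient_mat n g R *\<^sub>v (x \<cdot>\<^sub>v ?p) + quotient_mat n g T *\<^sub>v (y \<cdot>\<^sub>v ?p)) @\<^sub>v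
      (transpose_mat (quotient_mat n g T) *\<^sub>v (x \<cdot>\<^sub>v ?p) + quotient_mat n g L *\<^sub>v (y \<cdot>\<^sub>v ?p))"
    unfolding D by (rule four_block_mat_mult_vec[OF Q(1) Q(1) Q(2) Q(1)]) auto
  also have "\<dots> = (char_sum \<psi> R * x + char_sum \<psi> T * y) \<cdot>\<^sub>v ?p
      @\<^sub>v (cnj (char_sum \<psi> T) * x + char_sum \<psi> L * y) \<cdot>\<^sub>v ?p"
    using S mult_mat_vec[OF Q(1), of ?p] mult_mat_vec[OF Q(2), of ?p]
    by (simp add: Qv smult_smult_assoc add_smult_distrib_vec mult.commute)
  also have "\<dots> = l \<cdot>\<^sub>v ?v"
    unfolding x y smult_append_vec by (simp add: smult_smult_assoc)
  finally have "?D *\<^sub>v ?v = l \<cdot>\<^sub>v ?v" .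
  moreover have dim: "dim_row ?D = n + n"
    unfolding D quotient_mat_def by simp
  moreover have "?v \<noteq> 0\<^sub>v (n + n)"
  proof
    assume eq: "?v = 0\<^sub>v (n + n)"
    \<comment> \<open>The group is nonempty, so entries 0 and n exist. They are \<open>x\<close> and
      \<open>y\<close> times a nonzero character value.\<close>
    have "carrier G \<noteq> {}" by blast
    then have n: "0 < n"
      using g by (cases n) (auto simp: bij_betw_def)
    have "?v $ 0 = x * \<psi> (g 1)" "?v $ n = y * \<psi> (g 1)"
      using n by (auto simp: character_vec_def)
    moreover have "\<psi> (g 1) \<noteq> 0"
      using character_nonzero[OF \<psi> mem[OF n]] by simp
    ultimately show False
      using nz n unfolding eq by auto
  qed
  moreover have "?v \<in> carrier_vec (n + n)"
    by (intro append_carrier_vec) auto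
  ultimately show ?thesis
    unfolding eigenvector_def by simp
qed

end

section \<open>Spectrum, eigenvectors and orthogonality\<close>

theorem theorem3p2:
  fixes G :: "('a, 'b) monoid_scheme"
    and n :: nat
    and g :: "nat \<Rightarrow> 'a"
    and \<chi> :: "nat \<Rightarrow> 'a \<Rightarrow> complex"
    and R L T :: "'a set"
    and D :: "complex mat"
  assumes "comm_group G" and "finite (carrier G)"
    and "bij_betw g {1..n} (carrier G)" and "g 1 = \<one>\<^bsub>G\<^esub>"
    and "bij_betw \<chi> {1..n} (characters G)"
    and "R \<subseteq> carrier G" and "L \<subseteq> carrier G" and "T \<subseteq> carrier G"
    and "R = set_inv\<^bsub>G\<^esub> R" and "L = set_inv\<^bsub>G\<^esub> L"
    and "\<one>\<^bsub>G\<^esub> \<notin> R \<union> L"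
    and "D = adjacency_mat (BiCay G R L T) (bicay_vertex_list g n)"
  shows "spectrum D = {bicay_lambda R L T (\<chi> k) j | k j. k \<in> {1..n} \<and> j \<in> {0, 1}}
    \<and> proots (char_poly D) =
        image_mset (\<lambda>(k, j). bicay_lambda R L T (\<chi> k) j) (mset_set ({1..n} \<times> {0, 1}))
    \<and> (\<forall>k\<in>{1..n}. \<forall>j\<in>{0, 1}.
        eigenvector D (bicay_U n g \<chi> *\<^sub>v bicay_u n R L T \<chi> k j) (bicay_lambda R L T (\<chi> k) j))
    \<and> (\<forall>k\<in>{1..n}. \<forall>j\<in>{0, 1}. \<forall>k'\<in>{1..n}. \<forall>j'\<in>{0, 1}. (k, j) \<noteq> (k', j') \<longrightarrow>
        (bicay_U n g \<chi> *\<^sub>v bicay_u n R L T \<chi> k j)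
          \<bullet>c (bicay_U n g \<chi> *\<^sub>v bicay_u n R L T \<chi> k' j') = 0)"
  proof -
  interpret comm_group G by fact
  note fin = assms(2) and g = assms(3)
  have char: "\<chi> k \<in> characters G" if "k \<in> {1..n}" for k
    using that bij_betwE[OF assms(5)] by blast
  have real: "char_sum (\<chi> k) R \<in> \<real>" "char_sum (\<chi> k) L \<in> \<real>" if "k \<in> {1..n}" for k
    using char_sum_real[OF fin char[OF that]] assms by blast+
  define x y where "x = (\<lambda>k j. bicay_xi R L T (\<chi> k) (nat (2 + (-1) ^ j)))"
    and "y = (\<lambda>k j. bicay_xi R L T (\<chi> k) (nat (3 + (-1) ^ j)))"
  let ?v = "\<lambda>k j. bicay_U n g \<chi> *\<^sub>v bicay_u n R L T \<chi> k j"
  let ?p = "\<lambda>k. character_vec n g (\<chi> k)"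
  have rep: "\<exists>d. d \<noteq> 0 \<and> ?v k j = (d * x k j) \<cdot>\<^sub>v ?p k @\<^sub>v (d * y k j) \<cdot>\<^sub>v ?p k"
    if "k \<in> {1..n}" "j \<in> {0, 1}" for k j
  proof -
    have "x k j \<noteq> 0 \<or> y k j \<noteq> 0"
      using bicay_xi_eigen(3)[OF real[OF that(1)] that(2)] unfolding x_def y_def .
    then show ?thesis
      unfolding x_def y_def by (rule bicay_U_mult_bicay_u[OF that(1)]) blast
  qed
  have eig: "eigenvector D (?v k j) (bicay_lambda R L T (\<chi> k) j)"
    if k: "k \<in> {1..n}" and j: "j \<in> {0, 1}" for k j
  proof -
    obtain d where d: "d \<noteq> 0" "?v k j = (d * x k j) \<cdot>\<^sub>v ?p k @\<^sub>v (d * y k j) \<cdot>\<^sub>v ?p k"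
      using rep[OF k j] by blast
    note E = bicay_xi_eigen[OF real[OF k] j, where T = T, folded x_def y_def]
    show ?thesis
      unfolding d(2) assms(12)
    \<comment> \<open>The scalar equations are homogeneous, so they persist after scaling by
      \<open>d\<close>.\<close>
    proof (rule BiCay_eigenvector[OF fin g char[OF k] assms(6-10)])
      show "char_sum (\<chi> k) R * (d * x k j) + char_sum (\<chi> k) T * (d * y k j)
          = bicay_lambda R L T (\<chi> k) j * (d * x k j)"
        using arg_cong[OF E(1), of "(*) d"] unfolding x_def y_def by (simp add: algebra_simps)
      show "cnj (char_sum (\<chi> k) T) * (d * x k j) + char_sum (\<chi> k) L * (d * y k j)
          = bicay_lambda R L T (\<chi> k) j * (d * y k j)"
        using arg_cong[OF E(2), of "(*) d"] unfolding x_def y_def by (simp add: algebra_simps)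
      show "d * x k j \<noteq> 0 \<or> d * y k j \<noteq> 0"
        using E(3) d(1) unfolding x_def y_def by simp
    qed
  qed
  have orth: "?v k j \<bullet>c ?v k' j' = 0"
    if k: "k \<in> {1..n}" and j: "j \<in> {0, 1}" and k': "k' \<in> {1..n}" and j': "j' \<in> {0, 1}"
      and neq: "(k, j) \<noteq> (k', j')" for k j k' j'
  proof -
    obtain d where d: "?v k j = (d * x k j) \<cdot>\<^sub>v ?p k @\<^sub>v (d * y k j) \<cdot>\<^sub>v ?p k"
      using rep[OF k j] by blast
    obtain d' where d': "?v k' j' = (d' * x k' j') \<cdot>\<^sub>v ?p k' @\<^sub>v (d' * y k' j') \<cdot>\<^sub>v ?p k'"
      using rep[OF k' j'] by blast
    have prod: "?v k j \<bullet>c ?v k' j' = d * cnj d' *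
        (x k j * cnj (x k' j') + y k j * cnj (y k' j')) * (?p k \<bullet>c ?p k')"
      unfolding d d' by (subst cscalar_prod_append_smult[of _ n]) (auto simp: algebra_simps)
    show ?thesis
    \<comment> \<open>Distinct \<open>k\<close> give distinct characters, and the group factor
      vanishes; equal \<open>k\<close> leave opposite \<open>j\<close>, and the two-by-two factor
      vanishes.\<close>
    proof (cases "k = k'")
      case False
      then have "\<chi> k \<noteq> \<chi> k'"
        using k k' assms(5) by (meson bij_betw_def inj_on_def)
      then show ?thesis
        unfolding prod character_vec_cscalar_prod[OF g]
        using character_orthogonal[OF fin char[OF k] char[OF k']] by simp
    next
      case True
      have xi: "x k 0 * cnj (x k 1) + y k 0 * cnj (y k 1) = 0"
        using bicay_xi_eigen(4)[OF real[OF k] j] unfolding x_def y_def by simp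
      \<comment> \<open>Conjugation covers the reversed order of the two eigenvectors.\<close>
      then have xi': "x k 1 * cnj (x k 0) + y k 1 * cnj (y k 0) = 0"
        by (metis complex_cnj_add complex_cnj_cnj complex_cnj_mult complex_cnj_zero mult.commute)
      have "j = 0 \<and> j' = 1 \<or> j = 1 \<and> j' = 0"
        using True neq j j' by auto
      then show ?thesis
        unfolding prod using True xi xi' by auto
    qed
  qed
  \<comment> \<open>Indexing by pairs rather than by eigenvalues keeps coinciding eigenvalues apart
    and gives exactly as many vectors as the dimension.\<close>
  let ?I = "{1..n} \<times> {0, 1::nat}"
  have D: "D \<in> carrier_mat (2 * n) (2 * n)"
    unfolding assms(12) adjacency_mat_def bicay_vertex_list_def by (simp add: mult_2 del: upt_Suc)
  have I: "finite ?I" "card ?I = 2 * n"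
    by (auto simp: card_cartesian_product)
  have eigI: "eigenvector D (case i of (k, j) \<Rightarrow> ?v k j)
      (case i of (k, j) \<Rightarrow> bicay_lambda R L T (\<chi> k) j)" if "i \<in> ?I" for i
    using that eig by (cases i) auto
  have orthI: "(case i of (k, j) \<Rightarrow> ?v k j) \<bullet>c (case i' of (k, j) \<Rightarrow> ?v k j) = 0"
    if "i \<in> ?I" "i' \<in> ?I" "i \<noteq> i'" for i i'
    using that orth[of "fst i" "snd i" "fst i'" "snd i'"] by (simp add: case_prod_unfold mem_Times_iff)
  have "spectrum D = (\<lambda>(k, j). bicay_lambda R L T (\<chi> k) j) ` ?I"
    by (rule spectrum_orthogonal_eigenbasis[OF D I eigI orthI])
  also have "\<dots> = {bicay_lambda R L T (\<chi> k) j | k j. k \<in> {1..n} \<and> j \<in> {0, 1}}"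
    by (force simp: image_iff)
  finally have "spectrum D = {bicay_lambda R L T (\<chi> k) j | k j. k \<in> {1..n} \<and> j \<in> {0, 1}}" .
  moreover have "proots (char_poly D) =
      image_mset (\<lambda>(k, j). bicay_lambda R L T (\<chi> k) j) (mset_set ?I)"
    by (rule proots_orthogonal_eigenbasis[OF D I eigI orthI])
  ultimately show ?thesis
    by (intro conjI ballI impI eig orth)
qed

end
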